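(* Let $f(z)$ be an analytic function on an open set $\Omega\subset\mathbb{C}$ and let $z_1,\dots,z_m\in\Omega$ be $m$ different points. Then $f(z)$ has the multi-point Taylor expansion $$f(z)=\sum_{n=0}^{N-1}q_{n,m}(z)\prod_{k=1}^m(z-z_k)^{n}+r_N(z),$$ where $q_{n,m}(z)$ is the polynomial of degree $m-1$ $$q_{n,m}(z)=\sum_{j=1}^m a_{n,j}\,\frac{\prod_{k=1,k\ne j}^m(z-z_k)}{\prod_{k=1,k\ne j}^m(z_j-z_k)}$$ and the coefficients $a_{n,j}$ of this polynomial are given by the Cauchy integral $$a_{n,j}=\frac{1}{2\pi i}\int_C\frac{f(w)\,dw}{(w-z_j)\prod_{k=1}^m(w-z_k)^{n}}.$$ The remainder term $r_N(z)$ is given by the Cauchy integral $$r_N(z)=\frac{1}{2\pi i}\int_C\frac{f(w)\,dw}{(w-z)\left[\prod_{k=1}^m(w-z_k)\right]^N}\left[\prod_{k=1}^m(z-z_k)\right]^N.$$ The contour of integration $C$ is a simple closed loop which encircles the points $z_1,\dots,z_m$ (for $a_{n,j}$) and $z,z_1,\dots,z_m$ (for $r_N(z)$) in the counterclockwise direction and is contained in $\Omega$. The expansion is convergent for $z\in O_m$, where $$O_m=\Big\{z\in\Omega:\ \prod_{k=1}^m|z-z_k|<r\Big\},\qquad r=\inf_{w\in\mathbb{C}\setminus\Omega}\ \prod_{k=1}^m|w-z_k|,$$ that is, for $z$ inside the lemniscate $\prod_{k=1}^m|z-z_k|=r$. In particular, if $f(z)$ is an entire function ($\Omega=\mathbb{C}$),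 then the expansion converges for all $z\in\mathbb{C}$.
   Context: Empty sums are zero and empty products equal one. Convergence of the expansion means that $r_N(z)\to0$ as $N\to\infty$. If $\Omega=\mathbb{C}$, the infimum over the empty set is understood as $r=+\infty$.
   Formalization: The loop C must have its interior, not only itself, contained in Ω (else false: f=1/w on ℂ∖{0}, z_1=1, C=|w|=2); such C exists when the points lie in one component of Ω, and otherwise only the expansion and its convergence are claimed, with no Cauchy integrals. *)

theory Defs
  imports "HOL-Complex_Analysis.Complex_Analysis"
begin

text \<open>
  The base points are \<open>z 1, \<dots>, z m\<close>; values of \<open>z\<close> outside \<open>{1..m}\<close> are irrelevant.
\<close>

text \<open>
  A simple closed loop in \<open>\<Omega>\<close> encircling all points of \<open>S\<close> counterclockwise.  Since \<open>\<Omega>\<close> need not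
  be simply connected, the region bounded by the loop has to lie in \<open>\<Omega>\<close> as well; otherwise
  Cauchy's formula, and with it the expansion, fails (e.g. for \<open>1 / w\<close> on the punctured plane).
\<close>

definition encircling_loop :: "complex set \<Rightarrow> complex set \<Rightarrow> (real \<Rightarrow> complex) \<Rightarrow> bool" where
  "encircling_loop \<Omega> S C \<longleftrightarrow>
     valid_path C \<and> simple_path C \<and> pathfinish C = pathstart C \<and>
     path_image C \<subseteq> \<Omega> \<and> inside (path_image C) \<subseteq> \<Omega> \<and>
     S \<subseteq> inside (path_image C) \<and> (\<forall>p\<in>S. winding_number C p = 1)"

definition mp_coeff ::
  "(complex \<Rightarrow> complex) \<Rightarrow> (nat \<Rightarrow> complex) \<Rightarrow> nat \<Rightarrow> (real \<Rightarrow> complex) \<Rightarrow> nat \<Rightarrow> nat \<Rightarrow> complex" where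
  "mp_coeff f z m C n j =
     1 / (2 * complex_of_real pi * \<i>) *
     contour_integral C (\<lambda>w. f w / ((w - z j) * (\<Prod>k=1..m. (w - z k) ^ n)))"

definition mp_remainder ::
  "(complex \<Rightarrow> complex) \<Rightarrow> (nat \<Rightarrow> complex) \<Rightarrow> nat \<Rightarrow> (real \<Rightarrow> complex) \<Rightarrow> nat \<Rightarrow> complex \<Rightarrow> complex" where
  "mp_remainder f z m C N x =
     1 / (2 * complex_of_real pi * \<i>) *
     contour_integral C (\<lambda>w. f w / ((w - x) * (\<Prod>k=1..m. w - z k) ^ N)) *
     (\<Prod>k=1..m. x - z k) ^ N"

text \<open>The polynomial \<open>q\<^sub>n\<^sub>,\<^sub>m\<close>, for the row \<open>c = a n\<close> of coefficients.\<close>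

definition mp_poly :: "(nat \<Rightarrow> complex) \<Rightarrow> nat \<Rightarrow> (nat \<Rightarrow> complex) \<Rightarrow> complex poly" where
  "mp_poly z m c =
     (\<Sum>j=1..m. smult (c j / (\<Prod>k\<in>{1..m} - {j}. z j - z k)) (\<Prod>k\<in>{1..m} - {j}. [:- z k, 1:]))"

text \<open>Taken in the extended reals, so that the infimum is \<open>\<infinity>\<close> for \<open>\<Omega> = UNIV\<close>.\<close>

definition lemniscate_level :: "complex set \<Rightarrow> (nat \<Rightarrow> complex) \<Rightarrow> nat \<Rightarrow> ereal" where
  "lemniscate_level \<Omega> z m = (INF w \<in> - \<Omega>. ereal (\<Prod>k=1..m. cmod (w - z k)))"

definition lemniscate_region :: "complex set \<Rightarrow> (nat \<Rightarrow> complex) \<Rightarrow> nat \<Rightarrow> complex set" where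
  "lemniscate_region \<Omega> z m =
     {x \<in> \<Omega>. ereal (\<Prod>k=1..m. cmod (x - z k)) < lemniscate_level \<Omega> z m}"

end

theory Submission
  imports Defs
begin

text \<open>
  Lagrange interpolation gives \<open>f = g 0\<close> and \<open>g n = q n + P * g (Suc n)\<close> with \<open>P w = (\<Prod>k. w - z k)\<close>
  and each \<open>g n\<close> holomorphic, so that \<open>f = (\<Sum>n<N. q n * P ^ n) + P ^ N * g N\<close>.  Dividing by
  \<open>(w - x) * P w ^ N\<close> and integrating over a cycle that winds once around \<open>x\<close> and all \<open>z k\<close>, the sum
  contributes nothing, being a rational function that is \<open>O(1 / w\<^sup>2)\<close> at infinity with all poles
  encircled, and Cauchy's formula leaves \<open>g N x\<close>.  This yields both Cauchy integrals of the theorem: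
  the coefficients are \<open>a n j = g n (z j)\<close>, and the remainder is \<open>P x ^ N * g N x\<close>.

  For convergence the cycle is taken close to a lemniscate \<open>norm (P w) = \<rho>\<close> with \<open>norm (P x) < \<rho>\<close>.  It
  has one loop in each of finitely many components of the sublevel set, which are simply connected by
  the maximum principle; this also covers points \<open>z k\<close> in different components of \<open>\<Omega>\<close>, where no
  single encircling loop exists.
\<close>

section \<open>Cauchy integrals over cycles\<close>

text \<open>By the degree gap, \<open>w * poly p w / poly d w\<close> tends to 0 at infinity, so on
  a large circle the integrand is at most \<open>e / R\<close> against a length of
  \<open>2 * pi * R\<close>. Choosing \<open>R\<close> beyond all roots makes the circle wind once
  around each of them.\<close>

lemma contour_integral_rational_circle_bound:
  fixes p d :: "complex poly"
  assumes deg: "degree p + 2 \<le> degree d" and "0 < e"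
  obtains R where "0 < R" "\<And>w. poly d w = 0 \<Longrightarrow> norm w < R"
    "norm (contour_integral (circlepath 0 R) (\<lambda>w. poly p w / poly d w)) \<le> 2 * pi * e"
proof -
  have d0: "d \<noteq> 0" using deg by auto
  have fin: "finite {w. poly d w = 0}" by (rule poly_roots_finite[OF d0])
  have "((\<lambda>w. poly ([:0,1:] * p) w / poly d w) \<longlongrightarrow> 0) at_infinity"
    using deg by (intro poly_divide_tendsto_0_at_infinity) (auto intro: le_less_trans[OF degree_mult_le])
  from tendstoD[OF this \<open>0 < e\<close>] obtain b where b:
    "\<And>w. b \<le> norm w \<Longrightarrow> norm (w * poly p w / poly d w) < e"
    by (auto simp: eventually_at_infinity dist_norm)
  obtain B where B: "\<And>w. poly d w = 0 \<Longrightarrow> norm w \<le> B"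
    using finite_imp_bounded[OF fin] by (auto simp: bounded_iff)
  define R where "R = max b (max B 0) + 1"
  have R: "0 < R" "b \<le> R" "\<And>w. poly d w = 0 \<Longrightarrow> norm w < R"
    using B by (force simp: R_def)+
  have off: "path_image (circlepath 0 R) \<subseteq> - {w. poly d w = 0}"
    using R by (force simp: less_le)
  have "(\<lambda>w. poly p w / poly d w) contour_integrable_on circlepath 0 R"
    by (rule contour_integrable_holomorphic_simple[where S = "- {w. poly d w = 0}"])
      (use off in \<open>auto intro!: holomorphic_intros finite_imp_closed fin\<close>)
  then have "norm (contour_integral (circlepath 0 R) (\<lambda>w. poly p w / poly d w)) \<le> (e / R) * (2 * pi * R)"
  proof (rule has_contour_integral_bound_circlepath[OF has_contour_integral_integral])
    fix w :: complex assume "norm (w - 0) = R"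
    with b[of w] R show "norm (poly p w / poly d w) \<le> e / R"
      by (simp add: norm_mult norm_divide pos_le_divide_eq mult.commute)
  qed (use R \<open>0 < e\<close> in auto)
  with R show ?thesis by (intro that[of R]) (auto simp: mult_ac)
qed

text \<open>Both the cycle and a large circle wind once around every pole, so their integrals agree.\<close>

lemma cycle_integral_rational_eq_0:
  fixes p d :: "complex poly" and C :: "'i \<Rightarrow> real \<Rightarrow> complex"
  assumes deg: "degree p + 2 \<le> degree d"
    and vp: "\<And>i. i \<in> I \<Longrightarrow> valid_path (C i)"
    and loop: "\<And>i. i \<in> I \<Longrightarrow> pathfinish (C i) = pathstart (C i)"
    and nz: "\<And>i w. i \<in> I \<Longrightarrow> w \<in> path_image (C i) \<Longrightarrow> poly d w \<noteq> 0"
    and wn: "\<And>w. poly d w = 0 \<Longrightarrow> (\<Sum>i\<in>I. winding_number (C i) w) = 1"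
  shows "(\<Sum>i\<in>I. contour_integral (C i) (\<lambda>w. poly p w / poly d w)) = 0"
proof -
  define h where "h = (\<lambda>w. poly p w / poly d w)"
  define Z where "Z = {w. poly d w = 0}"
  define L where "L = 2 * pi * \<i> * (\<Sum>w\<in>Z. residue h w)"
  have fin: "finite Z" unfolding Z_def using deg by (intro poly_roots_finite) auto
  have hol: "h holomorphic_on UNIV - Z"
    unfolding h_def Z_def by (auto intro!: holomorphic_intros)
  have res: "contour_integral g h = 2 * pi * \<i> * (\<Sum>w\<in>Z. winding_number g w * residue h w)"
    if "valid_path g" "pathfinish g = pathstart g" "\<And>w. w \<in> path_image g \<Longrightarrow> poly d w \<noteq> 0" for g
    by (rule Residue_theorem[OF open_UNIV connected_UNIV fin hol]) (use that in \<open>auto simp: Z_def\<close>)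
  have "(\<Sum>i\<in>I. contour_integral (C i) h) =
      (\<Sum>i\<in>I. 2 * pi * \<i> * (\<Sum>w\<in>Z. winding_number (C i) w * residue h w))"
    by (intro sum.cong refl res) (use vp loop nz in auto)
  also have "\<dots> = 2 * pi * \<i> * (\<Sum>w\<in>Z. (\<Sum>i\<in>I. winding_number (C i) w) * residue h w)"
    unfolding sum_distrib_left[symmetric] sum_distrib_right by (subst sum.swap) simp
  also have "\<dots> = L"
    unfolding L_def using wn by (simp add: Z_def)
  finally have *: "(\<Sum>i\<in>I. contour_integral (C i) h) = L" .
  \<comment> \<open>\<open>L\<close> does not depend on the radius, while the circle integral that
    equals it can be made as small as desired.\<close>
  have "norm L \<le> 0 + e" if "0 < e" for e
  proof -
    obtain R where R: "0 < R" "\<And>w. poly d w = 0 \<Longrightarrow> norm w < R"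
      "norm (contour_integral (circlepath 0 R) h) \<le> 2 * pi * (e / (2 * pi))"
      using contour_integral_rational_circle_bound[OF deg, of "e / (2 * pi)"] \<open>0 < e\<close>
      by (auto simp: h_def)
    have "contour_integral (circlepath 0 R) h = L"
      unfolding L_def
      by (subst res) (use R in \<open>auto simp: Z_def winding_number_circlepath intro!: sum.cong\<close>)
    with R show ?thesis by simp
  qed
  then have "norm L \<le> 0" by (rule field_le_epsilon)
  with * show ?thesis by (simp add: h_def)
qed

text \<open>This is the homological form of a contour: the global Cauchy formula asks that no loop
  wind around a point off \<open>\<Omega>\<close>, and the normalisation on \<open>A\<close>
  concerns only the total winding number. A sum over an infinite set is 0, so the last clause forces
  \<open>I\<close> to be finite as soon as \<open>A\<close> is nonempty.\<close>

definition encircling_cycle ::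
  "complex set \<Rightarrow> complex set \<Rightarrow> 'i set \<Rightarrow> ('i \<Rightarrow> real \<Rightarrow> complex) \<Rightarrow> bool" where
  "encircling_cycle \<Omega> A I C \<longleftrightarrow>
     (\<forall>i\<in>I. valid_path (C i) \<and> pathfinish (C i) = pathstart (C i) \<and> path_image (C i) \<subseteq> \<Omega> - A \<and>
        (\<forall>w. w \<notin> \<Omega> \<longrightarrow> winding_number (C i) w = 0)) \<and>
     (\<forall>w\<in>A. (\<Sum>i\<in>I. winding_number (C i) w) = 1)"

text \<open>After division the integrand splits into \<open>g w / (w - x)\<close>, to which the
  global Cauchy formula applies loop by loop, and a rational function whose integrals cancel only
  when summed over the whole cycle.\<close>

lemma cycle_integral_interpolation_remainder:
  fixes S D :: "complex poly" and C :: "'i \<Rightarrow> real \<Rightarrow> complex"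
  assumes opn: "open \<Omega>" and hol: "g holomorphic_on \<Omega>" and xin: "x \<in> \<Omega>"
    and f: "\<And>w. w \<in> \<Omega> \<Longrightarrow> f w = poly S w + poly D w * g w"
    and deg: "S = 0 \<or> degree S < degree D" and "D \<noteq> 0"
    and cyc: "encircling_cycle \<Omega> (insert x {w. poly D w = 0}) I C"
  shows "(\<Sum>i\<in>I. contour_integral (C i) (\<lambda>w. f w / ((w - x) * poly D w))) = 2 * pi * \<i> * g x"
proof -
  have vp: "\<And>i. i \<in> I \<Longrightarrow> valid_path (C i)"
    and loop: "\<And>i. i \<in> I \<Longrightarrow> pathfinish (C i) = pathstart (C i)"
    and sub: "\<And>i. i \<in> I \<Longrightarrow> path_image (C i) \<subseteq> \<Omega>"
    and out: "\<And>i w. i \<in> I \<Longrightarrow> w \<notin> \<Omega> \<Longrightarrow> winding_number (C i) w = 0"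
    and nz: "\<And>i w. i \<in> I \<Longrightarrow> w \<in> path_image (C i) \<Longrightarrow> w \<noteq> x \<and> poly D w \<noteq> 0"
    and wn: "\<And>w. w = x \<or> poly D w = 0 \<Longrightarrow> (\<Sum>i\<in>I. winding_number (C i) w) = 1"
    using cyc unfolding encircling_cycle_def by auto
  define d where "d = [:- x, 1:] * D"
  have d: "poly d w = (w - x) * poly D w" for w by (simp add: d_def algebra_simps)
  have fin: "finite {w. poly D w = 0}" by (rule poly_roots_finite[OF \<open>D \<noteq> 0\<close>])
  have 1: "contour_integral (C i) (\<lambda>w. f w / ((w - x) * poly D w)) =
      2 * pi * \<i> * winding_number (C i) x * g x + contour_integral (C i) (\<lambda>w. poly S w / poly d w)"
    if "i \<in> I" for i
  proof (rule contour_integral_unique)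
    have "((\<lambda>w. g w / (w - x)) has_contour_integral 2 * pi * \<i> * winding_number (C i) x * g x) (C i)"
      by (rule Cauchy_integral_formula_global[OF opn hol xin]) (use that vp loop sub out nz in \<open>blast+\<close>)
    moreover have "(\<lambda>w. poly S w / poly d w) contour_integrable_on (C i)"
      by (rule contour_integrable_holomorphic_simple[where S = "- insert x {w. poly D w = 0}"])
        (use that nz vp in \<open>auto simp: d_def intro!: holomorphic_intros finite_imp_closed fin closed_insert\<close>)
    ultimately have "((\<lambda>w. g w / (w - x) + poly S w / poly d w) has_contour_integral
      (2 * pi * \<i> * winding_number (C i) x * g x + contour_integral (C i) (\<lambda>w. poly S w / poly d w))) (C i)"
      by (intro has_contour_integral_add has_contour_integral_integral)
    then show "((\<lambda>w. f w / ((w - x) * poly D w)) has_contour_integral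
      (2 * pi * \<i> * winding_number (C i) x * g x + contour_integral (C i) (\<lambda>w. poly S w / poly d w))) (C i)"
    proof (rule has_contour_integral_eq)
      fix w assume "w \<in> path_image (C i)"
      with nz sub that have "w \<noteq> x" "poly D w \<noteq> 0" "w \<in> \<Omega>" by auto
      then show "g w / (w - x) + poly S w / poly d w = f w / ((w - x) * poly D w)"
        by (simp add: f d add_divide_distrib add.commute)
    qed
  qed
  have "(\<Sum>i\<in>I. contour_integral (C i) (\<lambda>w. poly S w / poly d w)) = 0"
    using deg
  proof
    \<comment> \<open>The factor \<open>w - x\<close> raises the degree of the denominator by one,
      which turns the strict inequality into the required gap of 2.\<close>
    assume "degree S < degree D"
    then show ?thesis
      using \<open>D \<noteq> 0\<close> vp loop nz wn
      by (intro cycle_integral_rational_eq_0) (auto simp: d_def degree_mult_eq simp del: mult_pCons_left)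
  qed simp
  then have "(\<Sum>i\<in>I. contour_integral (C i) (\<lambda>w. f w / ((w - x) * poly D w))) =
      2 * pi * \<i> * (\<Sum>i\<in>I. winding_number (C i) x) * g x"
    by (simp add: 1 sum.distrib sum_distrib_left sum_distrib_right)
  with wn show ?thesis by simp
qed

text \<open>By compactness \<open>norm (q w)\<close> stays below some \<open>c < 1\<close> on the
  path, so the integrals decay like \<open>c ^ N\<close>.\<close>

lemma contour_integral_geometric_tendsto_0:
  assumes "open S" and F: "F holomorphic_on S" and q: "q holomorphic_on S"
    and vp: "valid_path C" and sub: "path_image C \<subseteq> S"
    and less: "\<And>w. w \<in> path_image C \<Longrightarrow> norm (q w) < 1"
  shows "(\<lambda>N. contour_integral C (\<lambda>w. F w * q w ^ N)) \<longlonglongrightarrow> 0"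
proof -
  have cp: "compact (path_image C)" "path_image C \<noteq> {}"
    using vp by (auto simp: compact_path_image valid_path_imp_path path_image_nonempty)
  have cS: "continuous_on S F" "continuous_on S q"
    using F q by (auto intro: holomorphic_on_imp_continuous_on)
  have cont: "continuous_on (path_image C) F" "continuous_on (path_image C) q"
    using cS sub continuous_on_subset by blast+
  obtain M where M: "\<And>w. w \<in> path_image C \<Longrightarrow> norm (F w) \<le> M"
    using compact_imp_bounded[OF compact_continuous_image[OF cont(1) cp(1)]]
    by (auto simp: bounded_iff)
  obtain w0 where w0: "w0 \<in> path_image C" "\<And>w. w \<in> path_image C \<Longrightarrow> norm (q w) \<le> norm (q w0)"
    using continuous_attains_sup[OF cp continuous_on_norm[OF cont(2)]] by auto
  obtain c where c: "norm (q w0) < c" "c < 1"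
    using less[OF w0(1)] dense by blast
  have "0 \<le> c" using c(1) norm_ge_zero[of "q w0"] by linarith
  \<comment> \<open>The length estimate is available for functions bounded on an open set containing
    the path. The slack in \<open>M + 1\<close>, and \<open>c\<close> lying strictly above the
    maximum, make \<open>T\<close> such a set.\<close>
  define T where "T = (S \<inter> F -` ball 0 (M + 1)) \<inter> (S \<inter> q -` ball 0 c)"
  have "open T"
    unfolding T_def using cS \<open>open S\<close> by (intro open_Int continuous_open_preimage) auto
  moreover have "path_image C \<subseteq> T"
  proof
    fix w assume "w \<in> path_image C"
    with sub M[of w] w0(2)[of w] c(1) show "w \<in> T" by (auto simp: T_def)
  qed
  ultimately have "\<exists>L. 0 < L \<and> (\<forall>f B. f holomorphic_on T \<and> (\<forall>w\<in>T. norm (f w) \<le> B) \<longrightarrow>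
      norm (contour_integral C f) \<le> L * B)"
    by (intro contour_integral_bound_exists vp)
  then obtain L where L: "f holomorphic_on T \<Longrightarrow> (\<And>w. w \<in> T \<Longrightarrow> norm (f w) \<le> B)
      \<Longrightarrow> norm (contour_integral C f) \<le> L * B" for f B
    by meson
  have le: "norm (contour_integral C (\<lambda>w. F w * q w ^ N)) \<le> L * ((M + 1) * c ^ N)" for N
  proof (rule L)
    show "(\<lambda>w. F w * q w ^ N) holomorphic_on T"
      by (intro holomorphic_intros holomorphic_on_subset[OF F] holomorphic_on_subset[OF q])
        (auto simp: T_def)
    fix w assume "w \<in> T"
    then have "norm (F w) \<le> M + 1" "norm (q w) \<le> c" by (auto simp: T_def)
    then show "norm (F w * q w ^ N) \<le> (M + 1) * c ^ N"
      unfolding norm_mult norm_power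
      by (intro mult_mono power_mono) (auto intro: order_trans[OF norm_ge_zero])
  qed
  have "(\<lambda>N. L * ((M + 1) * c ^ N)) \<longlonglongrightarrow> 0"
    using c \<open>0 \<le> c\<close> by (auto intro!: tendsto_mult_right_zero LIMSEQ_power_zero)
  then show ?thesis by (rule Lim_null_comparison[rotated]) (simp add: le)
qed

section \<open>Existence of encircling loops\<close>

lemma encircling_loop_mono:
  assumes "encircling_loop \<Omega> S C" "\<Omega> \<subseteq> \<Omega>'" "S' \<subseteq> S"
  shows "encircling_loop \<Omega>' S' C"
  using assms unfolding encircling_loop_def by blast

text \<open>Both the loop and the region it bounds lie in \<open>\<Omega>\<close>, which leaves only
  the outside for \<open>w\<close>.\<close>

lemma encircling_loop_winding_number_outside:
  assumes "encircling_loop \<Omega> S C" "w \<notin> \<Omega>"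
  shows "winding_number C w = 0"
proof (rule winding_number_zero_in_outside)
  show "w \<in> outside (path_image C)"
    using assms inside_Un_outside[of "path_image C"] unfolding encircling_loop_def by blast
qed (use assms in \<open>auto simp: encircling_loop_def valid_path_imp_path\<close>)

text \<open>By the open mapping theorem and compactness, the frontier of the image of the disc lies
  on the image of the circle. The outside of that curve is connected and unbounded, so if it met the
  bounded image of the disc, it would also meet this frontier.\<close>

lemma holomorphic_injective_circle_inside:
  assumes g: "g holomorphic_on ball 0 1" and inj: "inj_on g (ball 0 1)" and r: "0 < r" "r < 1"
  shows "g ` ball 0 r \<subseteq> inside (g ` sphere 0 r)"
proof
  have sub: "sphere 0 r \<subseteq> ball 0 1" "ball 0 r \<subseteq> ball 0 1" "cball 0 r \<subseteq> ball (0::complex) 1"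
    using r by auto
  have cont: "continuous_on (cball 0 r) g"
    using g sub holomorphic_on_imp_continuous_on continuous_on_subset by blast
  have opn: "open (g ` ball 0 r)"
    using g inj sub by (intro open_mapping_thm3) (auto intro: holomorphic_on_subset inj_on_subset)
  have cp: "compact (g ` cball 0 r)" "compact (g ` sphere 0 r)"
    using cont by (auto intro!: compact_continuous_image continuous_on_subset[OF cont])
  have "closure (g ` ball 0 r) \<subseteq> g ` cball 0 r"
    by (intro closure_minimal compact_imp_closed cp image_mono) auto
  also have "g ` cball 0 r = g ` ball 0 r \<union> g ` sphere 0 r"
    by (subst image_Un[symmetric], rule arg_cong[of _ _ "(`) g"]) auto
  finally have fr: "frontier (g ` ball 0 r) \<subseteq> g ` sphere 0 r"
    using opn by (auto simp: frontier_def interior_open)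
  fix y assume y: "y \<in> g ` ball 0 r"
  have y': "y \<notin> g ` sphere 0 r"
  proof
    assume "y \<in> g ` sphere 0 r"
    with y obtain u v where "g u = g v" "u \<in> ball 0 r" "v \<in> sphere 0 r" by auto
    with inj sub show False by (auto dest!: inj_onD)
  qed
  show "y \<in> inside (g ` sphere 0 r)"
  proof (rule ccontr)
    assume "y \<notin> inside (g ` sphere 0 r)"
    with y' have yo: "y \<in> outside (g ` sphere 0 r)"
      using inside_Un_outside[of "g ` sphere 0 r"] by blast
    have bd: "bounded (g ` sphere 0 r)" "bounded (g ` ball 0 r)"
      using cp compact_imp_bounded bounded_subset[OF compact_imp_bounded[OF cp(1)] image_mono] by auto
    have "\<not> bounded (outside (g ` sphere 0 r))"
      by (rule unbounded_outside[OF bd(1)])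
    with bd have "\<not> outside (g ` sphere 0 r) \<subseteq> g ` ball 0 r"
      using bounded_subset by blast
    moreover have "connected (outside (g ` sphere 0 r))"
      by (rule connected_outside[OF bd(1)]) simp
    ultimately have "outside (g ` sphere 0 r) \<inter> frontier (g ` ball 0 r) \<noteq> {}"
      using y yo by (intro connected_Int_frontier) auto
    with fr show False using outside_no_overlap[of "g ` sphere 0 r"] by blast
  qed
qed

lemma compact_subset_ball:
  fixes K :: "'a::real_normed_vector set"
  assumes "compact K" "K \<subseteq> ball 0 r"
  obtains s where "s < r" "K \<subseteq> ball 0 s"
proof (cases "K = {}")
  case True
  then show ?thesis using that[of "r - 1"] by simp
next
  case False
  then obtain w where w: "w \<in> K" "\<And>u. u \<in> K \<Longrightarrow> norm u \<le> norm w"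
    using continuous_attains_sup[OF assms(1) _ continuous_on_norm_id] by blast
  obtain s where "norm w < s" "s < r" using w(1) assms dense[of "norm w" r] by force
  with w show ?thesis by (force intro: that[of s])
qed

text \<open>The loop is the image of a circle close to the unit circle under a Riemann map.\<close>

lemma encircling_loop_simply_connected:
  assumes "open W" "simply_connected W" "W \<noteq> {}" "W \<noteq> UNIV" "compact K" "K \<subseteq> W"
  obtains C where "encircling_loop W K C"
proof -
  obtain f g where f: "f holomorphic_on W" and g: "g holomorphic_on ball 0 1"
    and fg: "\<And>w. w \<in> W \<Longrightarrow> f w \<in> ball 0 1 \<and> g (f w) = w"
    and gf: "\<And>u. u \<in> ball 0 1 \<Longrightarrow> g u \<in> W \<and> f (g u) = u"
    using Riemann_mapping_theorem[of W, THEN iffD1, OF conjI[OF assms(1,2)]] assms(3,4)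
    by (elim disjE exE conjE) auto
  have inj: "inj_on g (ball 0 1)" by (rule inj_on_inverseI[of _ f]) (use gf in auto)
  have "compact (f ` K)"
    using f assms holomorphic_on_imp_continuous_on continuous_on_subset
    by (intro compact_continuous_image) blast+
  moreover have "f ` K \<subseteq> ball 0 1" using fg assms by auto
  ultimately obtain s where s: "s < 1" "f ` K \<subseteq> ball 0 s"
    by (rule compact_subset_ball)
  \<comment> \<open>The radius has to be positive, whereas \<open>s\<close> need not be when
    \<open>K\<close> is empty.\<close>
  define r where "r = max s (1/2)"
  have r: "0 < r" "r < 1" "f ` K \<subseteq> ball 0 r" using s by (auto simp: r_def)
  define C where "C = g \<circ> circlepath 0 r"
  have im: "path_image C = g ` sphere 0 r" using r by (simp add: C_def path_image_compose)
  have vp: "valid_path C" unfolding C_def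
    by (rule valid_path_compose_holomorphic[OF _ g]) (use r in auto)
  have sp: "simple_path C" unfolding C_def
    by (rule simple_path_continuous_image)
      (use r in \<open>auto simp: simple_path_circlepath
        intro!: continuous_on_subset[OF holomorphic_on_imp_continuous_on[OF g]] inj_on_subset[OF inj]\<close>)
  have loop: "pathfinish C = pathstart C"
    by (simp add: C_def pathfinish_compose pathstart_compose)
  have sub: "path_image C \<subseteq> W" using r gf by (auto simp: im)
  then have ins: "inside (path_image C) \<subseteq> W"
    by (rule subset_simply_connected_imp_inside_subset[OF assms(2,1)])
  have K: "K \<subseteq> inside (path_image C)"
  proof
    fix x assume "x \<in> K"
    then have "x \<in> g ` ball 0 r" using r(3) fg[of x] assms by (metis image_iff subsetD)
    with holomorphic_injective_circle_inside[OF g inj r(1,2)] show "x \<in> inside (path_image C)"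
      by (auto simp: im)
  qed
  show ?thesis
  \<comment> \<open>A simple closed curve winds either once or minus once around its inside; in the
    second case the loop is reversed.\<close>
  proof (rule simple_closed_path_winding_number_inside[OF sp])
    assume "\<And>z. z \<in> inside (path_image C) \<Longrightarrow> winding_number C z = 1"
    with vp sp loop sub ins K have "encircling_loop W K C"
      unfolding encircling_loop_def by blast
    then show ?thesis by (rule that)
  next
    assume *: "\<And>z. z \<in> inside (path_image C) \<Longrightarrow> winding_number C z = -1"
    have "winding_number (reversepath C) p = 1" if "p \<in> K" for p
    proof -
      have p: "p \<in> inside (path_image C)" using K that by auto
      with inside_no_overlap[of "path_image C"] have "p \<notin> path_image C" by blast
      with *[OF p] show ?thesis by (simp add: winding_number_reversepath valid_path_imp_path vp)
    qed
    with vp sp loop sub ins K have "encircling_loop W K (reversepath C)"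
      unfolding encircling_loop_def by (simp add: simple_path_reversepath)
    then show ?thesis by (rule that)
  qed
qed

text \<open>A disc is moved by a homeomorphism so as to contain the given points.\<close>

lemma encircling_loop_exists_finite:
  assumes "open V" "connected V" "finite A" "A \<noteq> {}" "A \<subseteq> V"
  obtains C where "encircling_loop V A C"
proof -
  obtain a where "a \<in> V" using assms by blast
  with \<open>open V\<close> obtain e where e: "0 < e" "cball a e \<subseteq> V" by (meson open_contains_cball)
  \<comment> \<open>Any \<open>card A\<close> distinct points of a small disc serve as starting
    positions; the homeomorphism of \<open>V\<close> carries them to \<open>A\<close>, and the disc
    to a simply connected neighbourhood of \<open>A\<close>.\<close>
  have "infinite (ball a e)" using e finite_imp_not_open[of "ball a e"] by auto
  then obtain B where B: "B \<subseteq> ball a e" "finite B" "card B = card A"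
    using infinite_arbitrarily_large by metis
  obtain s where s: "bij_betw s A B" using finite_same_card_bij[OF \<open>finite A\<close>] B by metis
  have sin: "s p \<in> ball a e" if "p \<in> A" for p using bij_betwE[OF s] that B by blast
  obtain f g where fg: "homeomorphism V V f g" and f: "\<And>p. p \<in> A \<Longrightarrow> f (s p) = p"
  proof (rule homeomorphism_moving_points_exists[of V V A s "\<lambda>p. p"])
    show "s p \<in> V \<and> p \<in> V" if "p \<in> A" for p
      using sin[OF that] e that assms by auto
    show "pairwise (\<lambda>i j. s i \<noteq> s j \<and> i \<noteq> j) A"
      using s by (auto simp: pairwise_def bij_betw_def inj_on_def)
    show "V \<subseteq> affine hull V" by (rule hull_subset)
  qed (use assms in auto)
  have sub: "ball a e \<subseteq> V" using e by auto
  define W where "W = f ` ball a e"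
  have hom: "homeomorphism (ball a e) W f g"
    unfolding W_def by (rule homeomorphism_of_subsets[OF fg sub]) auto
  have "openin (top_of_set V) W"
    unfolding W_def by (rule homeomorphism_imp_open_map[OF fg]) (use sub in \<open>auto simp: openin_open_eq \<open>open V\<close>\<close>)
  then have "open W" using \<open>open V\<close> by (simp add: openin_open_eq)
  moreover have "simply_connected W"
    using hom homeomorphic_simply_connected[of "ball a e" W]
    by (auto simp: homeomorphic_def convex_imp_simply_connected)
  \<comment> \<open>The Riemann map excludes the whole plane. The closed disc still lies in
    \<open>V\<close>, so its image is compact and \<open>W\<close> is bounded.\<close>
  moreover have "W \<noteq> UNIV"
  proof -
    have "compact (f ` cball a e)"
      using continuous_on_subset[OF homeomorphism_cont1[OF fg] e(2)]
      by (intro compact_continuous_image) auto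
    then have "bounded W"
      unfolding W_def by (rule bounded_subset[OF compact_imp_bounded]) auto
    then show ?thesis using not_bounded_UNIV by blast
  qed
  moreover have "A \<subseteq> W" unfolding W_def using f sin by (metis image_eqI subsetI)
  moreover have "W \<subseteq> V" using fg sub unfolding W_def homeomorphism_def by blast
  ultimately obtain C where "encircling_loop W A C" "W \<subseteq> V"
    using encircling_loop_simply_connected[of W A] finite_imp_compact[OF \<open>finite A\<close>] \<open>A \<noteq> {}\<close> by auto
  then show ?thesis by (rule that[OF encircling_loop_mono]) simp
qed

section \<open>Cycles around compact sets\<close>

lemma encircling_loop_imp_cycle:
  assumes "encircling_loop \<Omega> A C"
  shows "encircling_cycle \<Omega> A {()} (\<lambda>_. C)"
proof -
  have "path_image C \<subseteq> \<Omega> - A"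
    using assms inside_no_overlap[of "path_image C"] unfolding encircling_loop_def by blast
  then show ?thesis
    using assms encircling_loop_winding_number_outside[OF assms]
    by (simp add: encircling_loop_def encircling_cycle_def)
qed

text \<open>A loop inside the component bounds a region on which, by the maximum principle, \<open>norm (f w) < \<rho>\<close>
  still holds; this region is joined to the component.\<close>

lemma simply_connected_sublevel_component:
  assumes hol: "f holomorphic_on UNIV" and V: "V \<in> components {w. norm (f w) < \<rho>}"
  shows "open V" "simply_connected V"
proof -
  define U where "U = {w. norm (f w) < \<rho>}"
  have V': "V \<in> components U" using V by (simp add: U_def)
  have "open U"
    unfolding U_def using hol
    by (intro open_Collect_less continuous_intros) (auto intro: holomorphic_on_imp_continuous_on)
  with V' show "open V" by (rule open_components[rotated])
  moreover have "winding_number g w = 0"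
    if g: "path g" "path_image g \<subseteq> V" "pathfinish g = pathstart g" and "w \<notin> V" for g w
  proof -
    define T where "T = path_image g \<union> inside (path_image g)"
    have cp: "compact (path_image g)" "path_image g \<noteq> {}"
      using g by (auto simp: compact_path_image path_image_nonempty)
    have cont: "continuous_on A f" for A
      using hol holomorphic_on_imp_continuous_on continuous_on_subset by blast
    obtain w0 where w0: "w0 \<in> path_image g" "\<And>u. u \<in> path_image g \<Longrightarrow> norm (f u) \<le> norm (f w0)"
      using continuous_attains_sup[OF cp continuous_on_norm[OF cont]] by auto
    have "norm (f u) \<le> norm (f w0)" if "u \<in> inside (path_image g)" for u
    proof (rule maximum_modulus_frontier[OF holomorphic_on_subset[OF hol] cont _ _ that])
      show "bounded (inside (path_image g))"
        using cp by (intro bounded_inside compact_imp_bounded)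
      show "norm (f v) \<le> norm (f w0)" if "v \<in> frontier (inside (path_image g))" for v
        using frontier_inside_subset[OF compact_imp_closed[OF cp(1)]] that w0(2) by auto
    qed auto
    moreover have "norm (f w0) < \<rho>"
      using w0(1) g(2) in_components_subset[OF V'] by (auto simp: U_def)
    ultimately have "T \<subseteq> U"
      using w0(2) by (fastforce simp: T_def U_def)
    moreover have "connected T"
      unfolding T_def using cp g
      by (intro connected_with_inside compact_imp_closed connected_path_image)
    moreover have "V \<inter> T \<noteq> {}" using cp(2) g(2) by (auto simp: T_def)
    ultimately have "T \<subseteq> V" by (intro components_maximal[OF V'])
    with \<open>w \<notin> V\<close> have "w \<in> outside (path_image g)"
      using inside_Un_outside[of "path_image g"] unfolding T_def by blast
    with g show ?thesis by (intro winding_number_zero_in_outside)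
  qed
  ultimately show "simply_connected V"
    unfolding simply_connected_eq_winding_number_zero[OF \<open>open V\<close>]
    using in_components_connected[OF V'] by blast
qed

text \<open>Finitely many components cover \<open>K\<close>, and each receives one loop around its
  share of \<open>K\<close>. Components are disjoint and a loop does not wind around points off its
  own component, so exactly one loop contributes at each point of \<open>K\<close>.\<close>

lemma encircling_cycle_exists_compact:
  assumes "open U" and sc: "\<And>V. V \<in> components U \<Longrightarrow> simply_connected V" and "U \<noteq> UNIV"
    and K: "compact K" "K \<subseteq> U"
  obtains I :: "complex set set" and C where "encircling_cycle U K I C"
proof -
  have opn: "open V" if "V \<in> components U" for V using \<open>open U\<close> that by (rule open_components)
  obtain I where I: "I \<subseteq> components U" "finite I" "K \<subseteq> \<Union>I"
    using compactE[OF K(1), of "components U"] K(2) Union_components[of U] opn by metis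
  have "\<exists>C. encircling_loop V (K \<inter> V) C" if "V \<in> I" for V
  proof -
    have V: "V \<in> components U" using that I by auto
    \<comment> \<open>Removing the other open components, rather than intersecting with the open set
      \<open>V\<close>, exhibits this part of \<open>K\<close> as compact.\<close>
    have "K \<inter> V = K - \<Union>(I - {V})"
      using I(1,3) components_nonoverlap[of V U] V by auto
    moreover have "open (\<Union>(I - {V}))" using I opn by auto
    ultimately have "compact (K \<inter> V)" using K(1) by (simp add: compact_diff)
    then show ?thesis
      using encircling_loop_simply_connected[OF opn[OF V] sc[OF V] in_components_nonempty[OF V]]
        in_components_subset[OF V] \<open>U \<noteq> UNIV\<close> by auto
  qed
  then obtain C where C: "\<And>V. V \<in> I \<Longrightarrow> encircling_loop V (K \<inter> V) (C V)" by metis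
  have "path_image (C V) \<subseteq> U - K" if "V \<in> I" for V
    using C[OF that] in_components_subset[of V U] that I inside_no_overlap[of "path_image (C V)"]
    unfolding encircling_loop_def by blast
  moreover have "winding_number (C V) w = 0" if "V \<in> I" "w \<notin> V" for V w
    using encircling_loop_winding_number_outside[OF C] that by blast
  moreover have "(\<Sum>V\<in>I. winding_number (C V) p) = 1" if "p \<in> K" for p
  proof -
    obtain V where V: "V \<in> I" "p \<in> V" using \<open>p \<in> K\<close> I(3) by blast
    have "(\<Sum>W\<in>I. winding_number (C W) p) = (\<Sum>W\<in>I. if W = V then 1 else 0)"
    proof (rule sum.cong[OF refl])
      fix W assume W: "W \<in> I"
      show "winding_number (C W) p = (if W = V then 1 else 0)"
      proof (cases "W = V")
        case True
        with C[OF V(1)] V \<open>p \<in> K\<close> show ?thesis by (auto simp: encircling_loop_def)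
      next
        case False
        with V W I(1) have "p \<notin> W" using components_nonoverlap[of V U W] by auto
        with False encircling_loop_winding_number_outside[OF C[OF W]] show ?thesis by simp
      qed
    qed
    also have "\<dots> = 1" using V I by simp
    finally show ?thesis .
  qed
  moreover have "valid_path (C V)" "pathfinish (C V) = pathstart (C V)" if "V \<in> I" for V
    using C[OF that] by (auto simp: encircling_loop_def)
  ultimately have "encircling_cycle U K I C"
    using I(1) in_components_subset unfolding encircling_cycle_def by blast
  then show ?thesis by (rule that)
qed

section \<open>Repeated Lagrange interpolation\<close>

text \<open>The roots are divided out one at a time. The difference quotient, completed by the
  derivative at \<open>a\<close>, is holomorphic by removability, and it still vanishes at the
  remaining roots because they differ from \<open>a\<close>.\<close>

lemma holomorphic_factor_roots:
  assumes "finite A" "open \<Omega>" "g holomorphic_on \<Omega>" "\<And>a. a \<in> A \<Longrightarrow> a \<in> \<Omega> \<and> g a = 0"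
  shows "\<exists>h. h holomorphic_on \<Omega> \<and> (\<forall>w\<in>\<Omega>. g w = (\<Prod>a\<in>A. w - a) * h w)"
  using assms(1,3,4)
proof (induction A arbitrary: g)
  case empty
  then show ?case by auto
next
  case (insert a A)
  define k where "k = (\<lambda>w. if w = a then deriv g a else (g w - g a) / (w - a))"
  have g: "g w = (w - a) * k w" for w
    using insert.prems(2)[of a] by (auto simp: k_def)
  have "k holomorphic_on \<Omega>"
    unfolding k_def by (rule pole_lemma_open[OF insert.prems(1) \<open>open \<Omega>\<close>])
  moreover have "b \<in> \<Omega> \<and> k b = 0" if "b \<in> A" for b
    using insert.prems(2)[of b] insert.hyps that g[of b] by auto
  ultimately obtain h where "h holomorphic_on \<Omega>" "\<forall>w\<in>\<Omega>. k w = (\<Prod>a\<in>A. w - a) * h w"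
    using insert.IH by blast
  with insert.hyps show ?case by (intro exI[of _ h]) (simp add: g)
qed

lemma degree_mp_poly: "degree (mp_poly z m c) \<le> m - 1"
  unfolding mp_poly_def
  by (intro degree_sum_le) (auto simp: degree_prod_sum_eq intro!: order_trans[OF degree_smult_le])

lemma poly_mp_poly_node:
  assumes "inj_on z {1..m}" "j \<in> {1..m}"
  shows "poly (mp_poly z m c) (z j) = c j"
proof -
  \<comment> \<open>Each Lagrange basis polynomial is 1 at its own node and 0 at the others.\<close>
  have "poly (mp_poly z m c) (z j) = (\<Sum>i=1..m. if i = j then c j else 0)"
    unfolding mp_poly_def poly_sum poly_smult poly_prod
  proof (rule sum.cong[OF refl])
    fix i assume i: "i \<in> {1..m}"
    have nz: "(\<Prod>k\<in>{1..m} - {j}. z j - z k) \<noteq> 0"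
      using assms by (auto dest: inj_onD)
    show "c i / (\<Prod>k\<in>{1..m} - {i}. z i - z k) * (\<Prod>k\<in>{1..m} - {i}. poly [:- z k, 1:] (z j)) =
        (if i = j then c j else 0)"
    proof (cases "i = j")
      case False
      with assms(2) have "(\<Prod>k\<in>{1..m} - {i}. poly [:- z k, 1:] (z j)) = 0"
        by (intro prod_zero) auto
      with False show ?thesis by simp
    qed (use nz in simp)
  qed
  also have "\<dots> = c j" using assms by simp
  finally show ?thesis .
qed

text \<open>The difference between \<open>g\<close> and its Lagrange polynomial vanishes at every
  node, hence is divisible by the product; injectivity allows this product to be indexed by
  \<open>k\<close>.\<close>

lemma interpolation_remainder:
  assumes "open \<Omega>" "g holomorphic_on \<Omega>" "inj_on z {1..m}" "z ` {1..m} \<subseteq> \<Omega>"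
  shows "\<exists>h. h holomorphic_on \<Omega> \<and>
    (\<forall>w\<in>\<Omega>. g w = poly (mp_poly z m (\<lambda>j. g (z j))) w + (\<Prod>k=1..m. w - z k) * h w)"
proof -
  have "\<exists>h. h holomorphic_on \<Omega> \<and>
    (\<forall>w\<in>\<Omega>. g w - poly (mp_poly z m (\<lambda>j. g (z j))) w = (\<Prod>a\<in>z ` {1..m}. w - a) * h w)"
    using assms poly_mp_poly_node[OF assms(3)]
    by (intro holomorphic_factor_roots holomorphic_intros) auto
  then show ?thesis
    using assms(3) by (simp add: prod.reindex algebra_simps)
qed

lemma multipoint_quotients_exist:
  assumes "open \<Omega>" "f holomorphic_on \<Omega>" "inj_on z {1..m}" "z ` {1..m} \<subseteq> \<Omega>"
  obtains g where "\<And>n. g n holomorphic_on \<Omega>"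
    "\<And>w N. w \<in> \<Omega> \<Longrightarrow> f w = (\<Sum>n<N. poly (mp_poly z m (\<lambda>j. g n (z j))) w * (\<Prod>k=1..m. w - z k) ^ n) +
       (\<Prod>k=1..m. w - z k) ^ N * g N w"
proof -
  \<comment> \<open>Dependent choice iterates the division; the clause for \<open>n = 0\<close>
    anchors the sequence at \<open>f\<close>.\<close>
  have "\<exists>g. \<forall>n. (g n holomorphic_on \<Omega> \<and> (n = 0 \<longrightarrow> g n = f)) \<and>
    (\<forall>w\<in>\<Omega>. g n w = poly (mp_poly z m (\<lambda>j. g n (z j))) w + (\<Prod>k=1..m. w - z k) * g (Suc n) w)"
  proof (rule dependent_nat_choice)
    show "\<exists>g. g holomorphic_on \<Omega> \<and> ((0::nat) = 0 \<longrightarrow> g = f)" using assms(2) by auto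
  next
    fix g and n :: nat
    assume "g holomorphic_on \<Omega> \<and> (n = 0 \<longrightarrow> g = f)"
    with interpolation_remainder[OF assms(1) _ assms(3,4), of g]
    show "\<exists>h. (h holomorphic_on \<Omega> \<and> (Suc n = 0 \<longrightarrow> h = f)) \<and>
      (\<forall>w\<in>\<Omega>. g w = poly (mp_poly z m (\<lambda>j. g (z j))) w + (\<Prod>k=1..m. w - z k) * h w)"
      by auto
  qed
  then obtain g where "\<forall>n. (g n holomorphic_on \<Omega> \<and> (n = 0 \<longrightarrow> g n = f)) \<and>
    (\<forall>w\<in>\<Omega>. g n w = poly (mp_poly z m (\<lambda>j. g n (z j))) w + (\<Prod>k=1..m. w - z k) * g (Suc n) w)" ..
  then have g: "\<And>n. g n holomorphic_on \<Omega>" "g 0 = f"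
    "\<And>n w. w \<in> \<Omega> \<Longrightarrow>
      g n w = poly (mp_poly z m (\<lambda>j. g n (z j))) w + (\<Prod>k=1..m. w - z k) * g (Suc n) w"
    by blast+
  show ?thesis
  proof (rule that[of g])
    fix w N assume w: "w \<in> \<Omega>"
    show "f w = (\<Sum>n<N. poly (mp_poly z m (\<lambda>j. g n (z j))) w * (\<Prod>k=1..m. w - z k) ^ n) +
       (\<Prod>k=1..m. w - z k) ^ N * g N w"
    proof (induction N)
      case 0
      then show ?case using g(2) by simp
    next
      case (Suc N)
      then show ?case using g(3)[OF w, of N] by (simp add: algebra_simps)
    qed
  qed (use g in auto)
qed

text \<open>The first \<open>N\<close> terms form a polynomial of degree below that of
  \<open>P ^ N\<close>, so the interpolation formula applies with divisor \<open>P ^ N\<close>. The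
  point \<open>x\<close> may be a node, which is how the coefficients are reached.\<close>

lemma multipoint_quotient_cycle_integral:
  assumes "open \<Omega>" "g N holomorphic_on \<Omega>" "x \<in> \<Omega>" "1 \<le> m"
    and f: "\<And>w. w \<in> \<Omega> \<Longrightarrow> f w = (\<Sum>n<N. poly (mp_poly z m (c n)) w * (\<Prod>k=1..m. w - z k) ^ n) +
       (\<Prod>k=1..m. w - z k) ^ N * g N w"
    and cyc: "encircling_cycle \<Omega> (insert x (z ` {1..m})) I C"
  shows "(\<Sum>i\<in>I. contour_integral (C i) (\<lambda>w. f w / ((w - x) * (\<Prod>k=1..m. w - z k) ^ N))) =
    2 * pi * \<i> * g N x"
proof -
  define P where "P = (\<Prod>k=1..m. [:- z k, 1:])"
  define S where "S = (\<Sum>n<N. mp_poly z m (c n) * P ^ n)"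
  have P0: "P \<noteq> 0" by (simp add: P_def)
  have degP: "degree P = m" by (simp add: P_def degree_prod_sum_eq)
  have P: "poly P w = (\<Prod>k=1..m. w - z k)" for w by (simp add: P_def poly_prod)
  \<comment> \<open>For \<open>N = 0\<close> both degrees are 0 and the empty sum gives
    \<open>S = 0\<close>. Otherwise term \<open>n\<close> has degree at most
    \<open>m - 1 + m * n\<close>, just below \<open>m * Suc n\<close>.\<close>
  have "S = 0 \<or> degree S < degree (P ^ N)"
  proof (cases N)
    case (Suc M)
    have "degree S < m * N"
      unfolding S_def
    proof (rule degree_sum_less)
      fix n assume "n \<in> {..<N}"
      have "degree (mp_poly z m (c n) * P ^ n) \<le> m - 1 + m * n"
        using degree_mp_poly[of z m "c n"] P0 degree_mult_le[of "mp_poly z m (c n)" "P ^ n"]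
        by (simp add: degree_power_eq degP mult.commute)
      also have "\<dots> < m * Suc n" using \<open>1 \<le> m\<close> by simp
      also have "\<dots> \<le> m * N" using \<open>n \<in> {..<N}\<close> by (intro mult_left_mono) auto
      finally show "degree (mp_poly z m (c n) * P ^ n) < m * N" .
    qed (use Suc \<open>1 \<le> m\<close> in auto)
    then show ?thesis using P0 by (simp add: degree_power_eq degP mult.commute)
  qed (simp add: S_def)
  moreover have "encircling_cycle \<Omega> (insert x {w. poly (P ^ N) w = 0}) I C"
  proof -
    \<comment> \<open>Only an inclusion holds in general, since for \<open>N = 0\<close> there are
      no roots.\<close>
    have "insert x {w. poly (P ^ N) w = 0} \<subseteq> insert x (z ` {1..m})"
      by (auto simp: P)
    with cyc show ?thesis unfolding encircling_cycle_def by blast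
  qed
  moreover have "f w = poly S w + poly (P ^ N) w * g N w" if "w \<in> \<Omega>" for w
    using f[OF that] by (simp add: S_def poly_sum P)
  ultimately have "(\<Sum>i\<in>I. contour_integral (C i) (\<lambda>w. f w / ((w - x) * poly (P ^ N) w))) = 2 * pi * \<i> * g N x"
    using P0 by (intro cycle_integral_interpolation_remainder[OF assms(1-3)]) auto
  then show ?thesis by (simp add: P)
qed

section \<open>Convergence inside the lemniscate\<close>

lemma multipoint_remainder_tendsto_0:
  assumes opn: "open \<Omega>" and f: "f holomorphic_on \<Omega>" and "1 \<le> m"
    and x: "ereal (\<Prod>k=1..m. cmod (x - z k)) < lemniscate_level \<Omega> z m"
    and quot: "\<And>N (I :: complex set set) C. encircling_cycle \<Omega> (insert x (z ` {1..m})) I C \<Longrightarrow>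
      (\<Sum>i\<in>I. contour_integral (C i) (\<lambda>w. f w / ((w - x) * (\<Prod>k=1..m. w - z k) ^ N))) =
      2 * pi * \<i> * g N x"
  shows "(\<lambda>N. (\<Prod>k=1..m. x - z k) ^ N * g N x) \<longlonglongrightarrow> 0"
proof -
  define P where "P = (\<Prod>k=1..m. [:- z k, 1:])"
  define Q where "Q = (\<lambda>w. \<Prod>k=1..m. w - z k)"
  have PQ: "poly P = Q" by (auto simp: P_def Q_def poly_prod)
  have degP: "degree P = m" by (simp add: P_def degree_prod_sum_eq)
  have normQ: "(\<Prod>k=1..m. cmod (w - z k)) = norm (Q w)" for w by (simp add: Q_def prod_norm)
  \<comment> \<open>A real \<open>\<rho>\<close> exists even for an infinite level. It keeps the
    loops inside \<open>\<Omega>\<close>, while the second level \<open>\<sigma>\<close> keeps them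
    away from \<open>x\<close> and the nodes.\<close>
  obtain \<rho> where \<rho>: "norm (Q x) < \<rho>" "ereal \<rho> < lemniscate_level \<Omega> z m"
    using ereal_dense2[OF x] unfolding normQ by auto
  obtain \<sigma> where \<sigma>: "norm (Q x) < \<sigma>" "\<sigma> < \<rho>" using dense[OF \<rho>(1)] by blast
  have "0 < \<sigma>" using le_less_trans[OF norm_ge_zero \<sigma>(1)] .
  define U where "U = {w. norm (Q w) < \<rho>}"
  define K where "K = {w. norm (Q w) \<le> \<sigma>}"
  have holQ: "Q holomorphic_on A" for A unfolding Q_def by (intro holomorphic_intros)
  then have contQ: "continuous_on A Q" for A by (rule holomorphic_on_imp_continuous_on)
  have "U \<subseteq> \<Omega>"
  proof
    fix w assume "w \<in> U"
    show "w \<in> \<Omega>"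
    proof (rule ccontr)
      assume "w \<notin> \<Omega>"
      then have "lemniscate_level \<Omega> z m \<le> ereal (norm (Q w))"
        unfolding lemniscate_level_def normQ by (intro INF_lower) auto
      with \<rho>(2) have "ereal \<rho> < ereal (norm (Q w))" by (rule less_le_trans)
      with \<open>w \<in> U\<close> show False by (simp add: U_def)
    qed
  qed
  have "open U" unfolding U_def by (intro open_Collect_less continuous_intros contQ)
  \<comment> \<open>A polynomial of positive degree has bounded sublevel sets. This makes
    \<open>K\<close> compact and \<open>U\<close> different from the plane.\<close>
  have "filterlim Q at_infinity at_infinity"
    using filterlim_poly_at_infinity[of P] \<open>1 \<le> m\<close> by (simp add: degP PQ)
  then have "\<forall>\<^sub>F w in at_infinity. \<rho> \<le> norm (Q w)"
    using filterlim_at_infinity_imp_norm_at_top by (auto simp: filterlim_at_top)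
  then obtain b where b: "\<And>w. b \<le> norm w \<Longrightarrow> \<rho> \<le> norm (Q w)"
    by (auto simp: eventually_at_infinity)
  have U: "U \<subseteq> ball 0 b"
  proof
    fix w assume "w \<in> U"
    with b[of w] show "w \<in> ball 0 b" by (cases "b \<le> norm w") (auto simp: U_def)
  qed
  then have "U \<noteq> UNIV" using not_bounded_UNIV bounded_subset[OF bounded_ball U] by auto
  have "K \<subseteq> U" using \<sigma> by (auto simp: K_def U_def)
  with U have "K \<subseteq> ball 0 b" by blast
  moreover have "closed K" unfolding K_def by (intro closed_Collect_le continuous_intros contQ)
  ultimately have "compact K" by (meson bounded_ball bounded_subset compact_eq_bounded_closed)
  have "simply_connected V" if "V \<in> components U" for V
    using simply_connected_sublevel_component[OF holQ] that by (simp add: U_def)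
  then obtain I :: "complex set set" and C where cyc: "encircling_cycle U K I C"
    by (rule encircling_cycle_exists_compact[OF \<open>open U\<close> _ \<open>U \<noteq> UNIV\<close> \<open>compact K\<close> \<open>K \<subseteq> U\<close>])
  have "norm (Q (z k)) = 0" if "k \<in> {1..m}" for k using that by (auto simp: Q_def)
  then have A: "insert x (z ` {1..m}) \<subseteq> K"
    using \<sigma> \<open>0 < \<sigma>\<close> by (auto simp: K_def)
  have vp: "valid_path (C V)" and pim: "path_image (C V) \<subseteq> U - K" if "V \<in> I" for V
    using cyc that by (auto simp: encircling_cycle_def)
  have cyc': "encircling_cycle \<Omega> (insert x (z ` {1..m})) I C"
    using cyc A \<open>U \<subseteq> \<Omega>\<close> unfolding encircling_cycle_def by blast
  \<comment> \<open>The cycle is the same for all \<open>N\<close>. On it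
    \<open>norm (Q x) < \<sigma> < norm (Q w)\<close>, so moving \<open>Q x ^ N\<close> under the
    integral produces powers of a ratio below 1.\<close>
  have "(\<lambda>N. contour_integral (C V) (\<lambda>w. f w / (w - x) * (Q x / Q w) ^ N)) \<longlonglongrightarrow> 0" if "V \<in> I" for V
  proof (rule contour_integral_geometric_tendsto_0[OF _ _ _ vp[OF that] pim[OF that]])
    show "open (U - K)" using \<open>open U\<close> \<open>closed K\<close> by (rule open_Diff)
    have "w \<noteq> x \<and> Q w \<noteq> 0" if "w \<in> U - K" for w
      using that A \<sigma> \<open>0 < \<sigma>\<close> by (auto simp: K_def)
    then show "(\<lambda>w. f w / (w - x)) holomorphic_on U - K" "(\<lambda>w. Q x / Q w) holomorphic_on U - K"
      using \<open>U \<subseteq> \<Omega>\<close> by (auto intro!: holomorphic_intros holomorphic_on_subset[OF f] holQ)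
    show "norm (Q x / Q w) < 1" if "w \<in> path_image (C V)" for w
      using pim[OF \<open>V \<in> I\<close>] that \<sigma> \<open>0 < \<sigma>\<close> by (auto simp: K_def norm_divide divide_simps)
  qed
  then have "(\<lambda>N. (\<Sum>V\<in>I. contour_integral (C V) (\<lambda>w. f w / (w - x) * (Q x / Q w) ^ N)) / (2 * pi * \<i>)) \<longlonglongrightarrow> 0"
    by (auto intro!: tendsto_divide_zero tendsto_null_sum)
  moreover have "(\<Sum>V\<in>I. contour_integral (C V) (\<lambda>w. f w / (w - x) * (Q x / Q w) ^ N)) / (2 * pi * \<i>) =
    Q x ^ N * g N x" for N
  proof -
    have "(\<Sum>V\<in>I. contour_integral (C V) (\<lambda>w. f w / (w - x) * (Q x / Q w) ^ N)) =
      (\<Sum>V\<in>I. Q x ^ N * contour_integral (C V) (\<lambda>w. f w / ((w - x) * Q w ^ N)))"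
    proof (rule sum.cong[OF refl])
      fix V assume "V \<in> I"
      have "(\<lambda>w. f w / ((w - x) * Q w ^ N)) contour_integrable_on (C V)"
      proof (rule contour_integrable_holomorphic_simple[OF _ _ vp[OF \<open>V \<in> I\<close>] pim[OF \<open>V \<in> I\<close>]])
        show "open (U - K)" using \<open>open U\<close> \<open>closed K\<close> by (rule open_Diff)
        have "w \<noteq> x \<and> Q w \<noteq> 0" if "w \<in> U - K" for w
          using that A \<sigma> \<open>0 < \<sigma>\<close> by (auto simp: K_def)
        then show "(\<lambda>w. f w / ((w - x) * Q w ^ N)) holomorphic_on U - K"
          using \<open>U \<subseteq> \<Omega>\<close> by (auto intro!: holomorphic_intros holomorphic_on_subset[OF f] holQ)
      qed
      then show "contour_integral (C V) (\<lambda>w. f w / (w - x) * (Q x / Q w) ^ N) =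
          Q x ^ N * contour_integral (C V) (\<lambda>w. f w / ((w - x) * Q w ^ N))"
        by (subst contour_integral_lmul[symmetric]) (auto simp: power_divide mult_ac)
    qed
    also have "\<dots> = Q x ^ N * (2 * pi * \<i> * g N x)"
      using quot[OF cyc', of N] by (simp add: Q_def flip: sum_distrib_left)
    finally have eq: "(\<Sum>V\<in>I. contour_integral (C V) (\<lambda>w. f w / (w - x) * (Q x / Q w) ^ N)) =
      Q x ^ N * (2 * pi * \<i> * g N x)" .
    show ?thesis unfolding eq by (simp add: mult_ac)
  qed
  ultimately show ?thesis by (simp only: Q_def)
qed

section \<open>The expansion, its Cauchy integrals and its convergence\<close>

text \<open>Coefficients and remainder are chosen before any contour, so the expansion also covers
  nodes in different components of \<open>\<Omega>\<close>, where no single loop exists; the first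
  conjunct shows that the contour formulas are not vacuous. The degree is only bounded by
  \<open>m - 1\<close> because leading coefficients may cancel.\<close>

theorem theorem2p3:
  fixes f :: "complex \<Rightarrow> complex" and \<Omega> :: "complex set"
    and z :: "nat \<Rightarrow> complex" and m :: nat
  assumes "open \<Omega>" and "f analytic_on \<Omega>"
    and "1 \<le> m" and "inj_on z {1..m}" and "z ` {1..m} \<subseteq> \<Omega>"
  shows
    "(\<forall>x\<in>\<Omega>. (\<forall>k\<in>{1..m}. connected_component \<Omega> x (z k)) \<longrightarrow>
        (\<exists>C. encircling_loop \<Omega> (insert x (z ` {1..m})) C)) \<and>
     (\<exists>(a :: nat \<Rightarrow> nat \<Rightarrow> complex) (r :: nat \<Rightarrow> complex \<Rightarrow> complex).
        (\<forall>C. encircling_loop \<Omega> (z ` {1..m}) C \<longrightarrow>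
           (\<forall>n. \<forall>j\<in>{1..m}. a n j = mp_coeff f z m C n j)) \<and>
        (\<forall>x\<in>\<Omega>. \<forall>C. encircling_loop \<Omega> (insert x (z ` {1..m})) C \<longrightarrow>
           (\<forall>N. r N x = mp_remainder f z m C N x)) \<and>
        (\<forall>n. degree (mp_poly z m (a n)) \<le> m - 1) \<and>
        (\<forall>x\<in>\<Omega>. \<forall>N.
           f x = (\<Sum>n<N. poly (mp_poly z m (a n)) x * (\<Prod>k=1..m. (x - z k) ^ n)) + r N x) \<and>
        (\<forall>x\<in>lemniscate_region \<Omega> z m. (\<lambda>N. r N x) \<longlonglongrightarrow> 0) \<and>
        lemniscate_region \<Omega> z m =
          {x. ereal (\<Prod>k=1..m. cmod (x - z k)) < lemniscate_level \<Omega> z m} \<and>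
        (\<Omega> = UNIV \<longrightarrow> (\<forall>x. (\<lambda>N. r N x) \<longlonglongrightarrow> 0)))"
proof -
  have f: "f holomorphic_on \<Omega>" by (rule analytic_imp_holomorphic[OF assms(2)])
  have loops: "\<exists>C. encircling_loop \<Omega> (insert x (z ` {1..m})) C"
    if "x \<in> \<Omega>" "\<forall>k\<in>{1..m}. connected_component \<Omega> x (z k)" for x
  proof -
    have "insert x (z ` {1..m}) \<subseteq> connected_component_set \<Omega> x"
      using that by auto
    then obtain C where "encircling_loop (connected_component_set \<Omega> x) (insert x (z ` {1..m})) C"
      using encircling_loop_exists_finite[OF open_connected_component[OF assms(1)]
          connected_connected_component, of "insert x (z ` {1..m})" x] by auto
    then show ?thesis using encircling_loop_mono connected_component_subset by blast
  qed
  obtain g where g: "\<And>n. g n holomorphic_on \<Omega>"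
    and fg: "\<And>w N. w \<in> \<Omega> \<Longrightarrow> f w = (\<Sum>n<N. poly (mp_poly z m (\<lambda>j. g n (z j))) w * (\<Prod>k=1..m. w - z k) ^ n) +
       (\<Prod>k=1..m. w - z k) ^ N * g N w"
    using multipoint_quotients_exist[OF assms(1) f assms(4,5)] by blast
  \<comment> \<open>The index type is generic: single loops use the unit type, convergence uses
    cycles indexed by components.\<close>
  have quot: "(\<Sum>i\<in>I. contour_integral (C i) (\<lambda>w. f w / ((w - x) * (\<Prod>k=1..m. w - z k) ^ N))) =
      2 * pi * \<i> * g N x"
    if "x \<in> \<Omega>" "encircling_cycle \<Omega> (insert x (z ` {1..m})) I C" for x N and I :: "'i set" and C
    using that by (intro multipoint_quotient_cycle_integral[OF assms(1) g _ assms(3) fg])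
  have loop_quot: "contour_integral C (\<lambda>w. f w / ((w - x) * (\<Prod>k=1..m. w - z k) ^ N)) = 2 * pi * \<i> * g N x"
    if "x \<in> \<Omega>" "encircling_loop \<Omega> (insert x (z ` {1..m})) C" for x N C
    using quot[OF that(1) encircling_loop_imp_cycle[OF that(2)], of N] by simp
  define a where "a = (\<lambda>n j. g n (z j))"
  define r where "r = (\<lambda>N x. (\<Prod>k=1..m. x - z k) ^ N * g N x)"
  have coeff: "a n j = mp_coeff f z m C n j"
    if "encircling_loop \<Omega> (z ` {1..m}) C" "j \<in> {1..m}" for C n j
  proof -
    \<comment> \<open>The coefficient formula is the quotient formula at \<open>x = z j\<close>,
      where a loop around the nodes suffices.\<close>
    have "insert (z j) (z ` {1..m}) = z ` {1..m}" "z j \<in> \<Omega>" using that assms(5) by auto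
    with loop_quot[of "z j" C n] that show ?thesis
      by (auto simp: a_def mp_coeff_def prod_power_distrib)
  qed
  have remainder: "r N x = mp_remainder f z m C N x"
    if "x \<in> \<Omega>" "encircling_loop \<Omega> (insert x (z ` {1..m})) C" for x C N
    using loop_quot[OF that, of N] by (simp add: r_def mp_remainder_def)
  have expansion: "f x = (\<Sum>n<N. poly (mp_poly z m (a n)) x * (\<Prod>k=1..m. (x - z k) ^ n)) + r N x"
    if "x \<in> \<Omega>" for x N
    using fg[OF that, of N] by (simp add: a_def r_def prod_power_distrib)
  \<comment> \<open>A point off \<open>\<Omega>\<close> takes part in the infimum, so its own
    product cannot lie strictly below the level.\<close>
  have region: "lemniscate_region \<Omega> z m =
      {x. ereal (\<Prod>k=1..m. cmod (x - z k)) < lemniscate_level \<Omega> z m}"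
    unfolding lemniscate_region_def lemniscate_level_def
    by (auto simp: not_le[symmetric] intro: INF_lower)
  have convergence: "(\<lambda>N. r N x) \<longlonglongrightarrow> 0" if "x \<in> lemniscate_region \<Omega> z m" for x
    unfolding r_def
  proof (rule multipoint_remainder_tendsto_0[OF assms(1) f assms(3)])
    show "ereal (\<Prod>k=1..m. cmod (x - z k)) < lemniscate_level \<Omega> z m"
      using that by (simp add: lemniscate_region_def)
    have "x \<in> \<Omega>" using that by (simp add: lemniscate_region_def)
    then show "(\<Sum>i\<in>I. contour_integral (C i) (\<lambda>w. f w / ((w - x) * (\<Prod>k=1..m. w - z k) ^ N))) =
      2 * pi * \<i> * g N x" if "encircling_cycle \<Omega> (insert x (z ` {1..m})) I C"
      for N and I :: "complex set set" and C
      using quot that by blast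
  qed
  \<comment> \<open>The infimum over the empty set is infinite.\<close>
  have "lemniscate_region \<Omega> z m = UNIV" if "\<Omega> = UNIV"
    unfolding region using that by (simp add: lemniscate_level_def top_ereal_def)
  with loops coeff remainder degree_mp_poly expansion convergence region show ?thesis
    by (intro conjI exI[of _ a] exI[of _ r]) blast+
qed

end
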